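(* Let $H=\{6k+1:k\in\mathbb Z\}$. In the prime lattice $H\times H$ the geometric locus of the prime twins is the bisector $y=-x+2$ of the second (resp. fourth) quadrant. That is, the map $(q,p)\mapsto(-q,p)$ is a bijection from the set of pairs of primes $q,p>3$ with $p-q=2$ onto the set of points $(x,y)\in H\times H$ with $x<0<y$, $x+y=2$ and $|x|,|y|$ both prime; and $(q,p)\mapsto(p,-q)$ is a bijection from the same set of prime pairs onto the set of points $(x,y)\in H\times H$ with $y<0<x$, $x+y=2$ and $|x|,|y|$ both prime.
   Context: The prime lattice $H\times H$ is regarded as a rectangular coordinate system with origin $(1,1)$; its second quadrant consists of points with negative first and positive second coordinate, its fourth quadrant of those with positive first and negative second coordinate. A negative element $-q\in H$ is counted as a prime if $q$ is prime. Prime twins here are pairs of primes greater than $3$ differing by $2$. *)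

theory Defs
  imports "HOL-Computational_Algebra.Primes"
begin

definition H :: "int set" where
  "H = {6 * k + 1 | k. True}"

text \<open>Library primes are positive, whereas a negative element \<open>-q\<close> of \<open>H\<close> also counts as a
  prime when \<open>q\<close> is prime; hence the absolute value.\<close>

definition prime_point :: "int \<times> int \<Rightarrow> bool" where
  "prime_point P \<longleftrightarrow> prime \<bar>fst P\<bar> \<and> prime \<bar>snd P\<bar>"

definition prime_twins :: "(int \<times> int) set" where
  "prime_twins = {(q, p). prime q \<and> prime p \<and> q > 3 \<and> p > 3 \<and> p - q = 2}"

definition second_quadrant :: "(int \<times> int) set" where
  "second_quadrant = {(x, y) \<in> H \<times> H. x < 0 \<and> 0 < y}"

definition fourth_quadrant :: "(int \<times> int) set" where
  "fourth_quadrant = {(x, y) \<in> H \<times> H. y < 0 \<and> 0 < x}"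

end

theory Submission
  imports Defs
begin

text \<open>Neither 2 nor 3 divides a prime above 3, so in a twin pair \<open>q\<close>,
  \<open>q + 2\<close> the smaller prime is 5 and the larger 1 modulo 6; hence \<open>- q\<close>
  and \<open>p\<close> lie in \<open>H\<close>. Conversely, a positive \<open>q\<close> with
  \<open>- q\<close> in \<open>H\<close> is at least 5. So \<open>prime_twins_iff\<close> turns
  twins into lattice points, and both maps are invertible coordinate changes.\<close>

lemma mem_H_iff: "x \<in> H \<longleftrightarrow> x mod 6 = 1"
  unfolding H_def mem_Collect_eq by presburger

lemma prime_gt_3_not_dvd:
  fixes p :: int
  assumes "prime p" "p > 3"
  shows "\<not> 2 dvd p" "\<not> 3 dvd p"
  using assms primes_dvd_imp_eq[of 2 p] primes_dvd_imp_eq[of 3 p] by auto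

lemma prime_twins_mem_H:
  assumes "(q, p) \<in> prime_twins"
  shows "- q \<in> H" "p \<in> H"
proof -
  have pq: "p = q + 2" and "\<not> 2 dvd q" "\<not> 3 dvd q" "\<not> 3 dvd q + 2"
    using assms prime_gt_3_not_dvd[of q] prime_gt_3_not_dvd[of p]
    by (auto simp: prime_twins_def algebra_simps)
  \<comment> \<open>As 3 divides neither \<open>q\<close> nor \<open>q + 2\<close>, \<open>q\<close>
    is 2 modulo 3; it is also odd.\<close>
  then have "q mod 6 = 5"
    by presburger
  then show "- q \<in> H" "p \<in> H"
    unfolding mem_H_iff pq by presburger+
qed

text \<open>Trades the bound 3 for membership in \<open>H\<close>, so that the quadrant conditions
  match by unfolding.\<close>

lemma prime_twins_iff:
  "(q, p) \<in> prime_twins \<longleftrightarrow>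
    - q \<in> H \<and> p \<in> H \<and> 0 < q \<and> 0 < p \<and> p - q = 2 \<and> prime q \<and> prime p"
  (is "?L \<longleftrightarrow> ?R")
proof
  assume ?L
  then show ?R
    using prime_twins_mem_H[of q p] by (simp add: prime_twins_def)
next
  assume R: ?R
  then have "(- q) mod 6 = 1" "0 < q"
    by (simp_all add: mem_H_iff)
  \<comment> \<open>The least positive integer congruent to 5 modulo 6 is 5;
    \<open>p = q + 2\<close> then exceeds 3 as well.\<close>
  then have "q > 3"
    by presburger
  with R show ?L
    by (simp add: prime_twins_def)
qed

theorem mainTheorem6:
  shows "bij_betw (\<lambda>(q, p). (- q, p)) prime_twins
           {(x, y) \<in> second_quadrant. x + y = 2 \<and> prime_point (x, y)}
     \<and> bij_betw (\<lambda>(q, p). (p, - q)) prime_twins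
           {(x, y) \<in> fourth_quadrant. x + y = 2 \<and> prime_point (x, y)}"
proof
  show "bij_betw (\<lambda>(q, p). (- q, p)) prime_twins
          {(x, y) \<in> second_quadrant. x + y = 2 \<and> prime_point (x, y)}"
    by (rule bij_betw_byWitness[where f' = "\<lambda>(x, y). (- x, y)"])
      (auto simp: prime_twins_iff second_quadrant_def prime_point_def)
  show "bij_betw (\<lambda>(q, p). (p, - q)) prime_twins
          {(x, y) \<in> fourth_quadrant. x + y = 2 \<and> prime_point (x, y)}"
    by (rule bij_betw_byWitness[where f' = "\<lambda>(x, y). (- y, x)"])
      (auto simp: prime_twins_iff fourth_quadrant_def prime_point_def)
qed

end
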